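(* For every $n>0$, the identity element of the Sandpile group of the level $n$ Sierpinski gasket cell graph $SGC_n$ with the normal boundary condition is the configuration having $2$ chips on each (non-sink) vertex.
   Context: The cell graph $SGC_n$ of the level $n$ Sierpinski gasket has one vertex for each of the $3^n$ level-$n$ cells, two vertices being adjacent if the corresponding cells meet. Explicitly: the vertices are the words of length $n$ over $\{0,1,2\}$, and two distinct words are adjacent iff they have the form $w\,i\,j^k$ and $w\,j\,i^k$ for some $k\ge 0$, some word $w$ of length $n-1-k$, and some $i\ne j$ in $\{0,1,2\}$. Thus $SGC_1$ is a triangle. The three corner (boundary) vertices are the constant words $0^n,1^n,2^n$. Normal boundary condition: a sink vertex is added and each of the three corner vertices is joined to the sink by exactly one edge (so every non-sink vertex has degree 3). Sandpile model: a configuration is a function $\eta$ from non-sink vertices to $\{0,1,2,\dots\}$. A vertex with $\eta(v)\ge\deg(v)$ is unstable and may topple, sending one chip along each incident edge; chips reaching the sink disappear. $\eta^\circ$ denotes the resulting stable configuration after toppling until all non-sink vertices are stable (independent of order). A configuration $\sigma$ is recurrent if it is stable and for every configuration $\eta$ there is a configuration $\eta'$ with $\sigma=(\eta+\eta')^\circ$. The Sandpile group is the set of recurrent configurations with operation $\eta_1\oplus\eta_2=(\eta_1+\eta_2)^\circ$. *)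

theory Defs
  imports Main "HOL-Algebra.Group"
begin

record 'v sink_graph =
  verts :: "'v set"
  adj :: "'v \<Rightarrow> 'v \<Rightarrow> bool"
  sink :: 'v

definition nonsink :: "'v sink_graph \<Rightarrow> 'v set" where
  "nonsink G = verts G - {sink G}"

definition deg :: "'v sink_graph \<Rightarrow> 'v \<Rightarrow> nat" where
  "deg G v = card {u \<in> verts G. adj G v u}"

(* Functions on the non-sink vertices are represented by total functions that
   vanish elsewhere, so that equality of configurations is equality in HOL. *)
definition configs :: "'v sink_graph \<Rightarrow> ('v \<Rightarrow> nat) set" where
  "configs G = {\<eta>. \<forall>v. v \<notin> nonsink G \<longrightarrow> \<eta> v = 0}"

definition config_add :: "('v \<Rightarrow> nat) \<Rightarrow> ('v \<Rightarrow> nat) \<Rightarrow> 'v \<Rightarrow> nat" where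
  "config_add \<eta> \<eta>' = (\<lambda>v. \<eta> v + \<eta>' v)"

definition stable :: "'v sink_graph \<Rightarrow> ('v \<Rightarrow> nat) \<Rightarrow> bool" where
  "stable G \<eta> \<longleftrightarrow> (\<forall>v \<in> nonsink G. \<eta> v < deg G v)"

(* Chips sent to the sink are dropped. *)
definition topple :: "'v sink_graph \<Rightarrow> 'v \<Rightarrow> ('v \<Rightarrow> nat) \<Rightarrow> 'v \<Rightarrow> nat" where
  "topple G v \<eta> = (\<lambda>u. if u = v then \<eta> v - deg G v
                       else if u \<in> nonsink G \<and> adj G v u then \<eta> u + 1
                       else \<eta> u)"

definition topple_step :: "'v sink_graph \<Rightarrow> ('v \<Rightarrow> nat) \<Rightarrow> ('v \<Rightarrow> nat) \<Rightarrow> bool" where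
  "topple_step G \<eta> \<eta>' \<longleftrightarrow> (\<exists>v \<in> nonsink G. deg G v \<le> \<eta> v \<and> \<eta>' = topple G v \<eta>)"

definition stabilize :: "'v sink_graph \<Rightarrow> ('v \<Rightarrow> nat) \<Rightarrow> 'v \<Rightarrow> nat" where
  "stabilize G \<eta> = (THE \<sigma>. (topple_step G)\<^sup>*\<^sup>* \<eta> \<sigma> \<and> stable G \<sigma>)"

definition recurrent :: "'v sink_graph \<Rightarrow> ('v \<Rightarrow> nat) \<Rightarrow> bool" where
  "recurrent G \<sigma> \<longleftrightarrow> \<sigma> \<in> configs G \<and> stable G \<sigma> \<and>
     (\<forall>\<eta> \<in> configs G. \<exists>\<eta>' \<in> configs G. \<sigma> = stabilize G (config_add \<eta> \<eta>'))"

definition sandpile_add :: "'v sink_graph \<Rightarrow> ('v \<Rightarrow> nat) \<Rightarrow> ('v \<Rightarrow> nat) \<Rightarrow> 'v \<Rightarrow> nat" where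
  "sandpile_add G \<eta> \<eta>' = stabilize G (config_add \<eta> \<eta>')"

(* The monoid record requires a unit field; it is the two-sided identity, which
   is unique if it exists. *)
definition sandpile_group :: "'v sink_graph \<Rightarrow> ('v \<Rightarrow> nat) monoid" where
  "sandpile_group G =
     \<lparr>carrier = {\<sigma>. recurrent G \<sigma>},
      mult = sandpile_add G,
      one = (THE e. recurrent G e \<and>
               (\<forall>\<sigma>. recurrent G \<sigma> \<longrightarrow> sandpile_add G e \<sigma> = \<sigma> \<and> sandpile_add G \<sigma> e = \<sigma>))\<rparr>"

definition words :: "nat \<Rightarrow> nat list set" where
  "words n = {w. length w = n \<and> set w \<subseteq> {0, 1, 2}}"

definition cell_adj :: "nat \<Rightarrow> nat list \<Rightarrow> nat list \<Rightarrow> bool" where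
  "cell_adj n u v \<longleftrightarrow> u \<in> words n \<and> v \<in> words n \<and>
     (\<exists>w i j k. i \<noteq> j \<and> u = w @ i # replicate k j \<and> v = w @ j # replicate k i)"

definition corners :: "nat \<Rightarrow> nat list set" where
  "corners n = {replicate n 0, replicate n 1, replicate n 2}"

(* The cell graph with normal boundary condition: None is the sink. The three
   corners are distinct only for n > 0. *)
definition SGC :: "nat \<Rightarrow> nat list option sink_graph" where
  "SGC n =
     \<lparr>verts = insert None (Some ` words n),
      adj = (\<lambda>x y. case (x, y) of
               (Some u, Some v) \<Rightarrow> cell_adj n u v
             | (Some u, None) \<Rightarrow> u \<in> corners n
             | (None, Some v) \<Rightarrow> v \<in> corners n
             | (None, None) \<Rightarrow> False),
      sink = None\<rparr>"

end

theory Submission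
  imports Defs
begin

text \<open>A recurrent configuration is reached from the maximal stable configuration \<open>m\<close> by adding chips
  and stabilizing, so \<open>m\<close> is the identity as soon as \<open>m + m\<close> stabilizes to \<open>m\<close>. This follows from the
  existence of an integer function \<open>u\<close>, vanishing at the sink, whose Laplacian is \<open>m\<close>: by the least action
  principle the odometer of \<open>m + m\<close> is at most \<open>u\<close>, and by the maximum principle it is at least \<open>u\<close>.
  On the cell graph, where \<open>m\<close> is constantly 2, \<open>u\<close> is found by following the electrical flow from a cell
  to its three subcells.\<close>

section \<open>Stabilization\<close>

locale sandpile =
  fixes G :: "'v sink_graph"
  assumes finite_verts: "finite (verts G)"
    and adj_irrefl: "\<not> adj G v v"
    and adj_sym: "adj G v w \<Longrightarrow> adj G w v"
begin

text \<open>The reduced Laplacian: \<open>f\<close> counts as zero at the sink, while edges to the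
  sink still enter through \<open>deg\<close>.\<close>

definition laplacian :: "('v \<Rightarrow> int) \<Rightarrow> 'v \<Rightarrow> int" where
  "laplacian f v = int (deg G v) * f v - (\<Sum>w | w \<in> nonsink G \<and> adj G v w. f w)"

lemma finite_nonsink: "finite (nonsink G)"
  using finite_verts by (simp add: nonsink_def)

lemma finite_nbrs: "finite {w. w \<in> nonsink G \<and> adj G v w}"
  using finite_nonsink by simp

lemma card_nbrs_le_deg: "card {w. w \<in> nonsink G \<and> adj G v w} \<le> deg G v"
  unfolding deg_def by (rule card_mono) (auto simp: finite_verts nonsink_def)

lemma laplacian_diff: "laplacian (\<lambda>v. f v - g v) v = laplacian f v - laplacian g v"
  by (simp add: laplacian_def sum_subtractf algebra_simps)

lemma laplacian_cmult: "laplacian (\<lambda>v. c * f v) v = c * laplacian f v"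
  by (simp add: laplacian_def sum_distrib_left algebra_simps)

lemma laplacian_mono_at:
  assumes "f v = g v" "\<And>w. w \<in> nonsink G \<Longrightarrow> f w \<le> g w"
  shows "laplacian g v \<le> laplacian f v"
  unfolding laplacian_def using assms by (auto intro!: sum_mono)

text \<open>The added term is column \<open>v\<close> of the Laplacian matrix;
  \<open>adj_sym\<close> brings it into the form \<open>adj G v w\<close> used by
  \<open>topple\<close>.\<close>

lemma laplacian_fun_upd:
  assumes "v \<in> nonsink G"
  shows "laplacian (f(v := f v + 1)) w =
    laplacian f w + (if w = v then int (deg G v) else if adj G v w then - 1 else 0)"
proof -
  have "(\<Sum>x | x \<in> nonsink G \<and> adj G w x. (f(v := f v + 1)) x) =
      (\<Sum>x | x \<in> nonsink G \<and> adj G w x. f x + (if x = v then 1 else 0))"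
    by (rule sum.cong) auto
  also have "\<dots> = (\<Sum>x | x \<in> nonsink G \<and> adj G w x. f x) + (if adj G w v then 1 else 0)"
    using assms finite_nbrs by (simp add: sum.distrib sum.delta')
  finally show ?thesis
    using adj_irrefl adj_sym by (auto simp: laplacian_def algebra_simps)
qed

text \<open>At a vertex where a positive maximum is attained, the neighbours contribute at most
  \<open>deg\<close> times that maximum, so the Laplacian there is nonnegative.\<close>

lemma maximum_principle:
  assumes "\<And>v. v \<in> nonsink G \<Longrightarrow> laplacian f v < 0" "x \<in> nonsink G"
  shows "f x \<le> 0"
proof (rule ccontr)
  assume "\<not> f x \<le> 0"
  have "Max (f ` nonsink G) \<in> f ` nonsink G"
    using finite_nonsink assms(2) by (intro Max_in) auto
  then obtain y where y: "y \<in> nonsink G" "f y = Max (f ` nonsink G)" by auto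
  have le: "f z \<le> f y" if "z \<in> nonsink G" for z
    using that finite_nonsink y by simp
  have pos: "f y > 0" using le[OF assms(2)] \<open>\<not> f x \<le> 0\<close> by simp
  have "(\<Sum>w | w \<in> nonsink G \<and> adj G y w. f w)
      \<le> (\<Sum>w | w \<in> nonsink G \<and> adj G y w. f y)"
    by (rule sum_mono) (simp add: le)
  also have "\<dots> = int (card {w. w \<in> nonsink G \<and> adj G y w}) * f y" by simp
  also have "\<dots> \<le> int (deg G y) * f y"
    using card_nbrs_le_deg[of y] pos by (intro mult_right_mono) auto
  finally have "laplacian f y \<ge> 0" by (simp add: laplacian_def)
  with assms(1)[OF y(1)] show False by simp
qed

text \<open>Since the toppling is legal, the truncated subtraction in \<open>topple\<close> is
  exact; \<open>f\<close> counts the topplings at each vertex.\<close>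

lemma topple_laplacian:
  assumes "v \<in> nonsink G" "deg G v \<le> \<eta> v" "w \<in> nonsink G"
    and "\<And>w. w \<in> nonsink G \<Longrightarrow> int (\<eta> w) = int (\<xi> w) - laplacian f w"
  shows "int (topple G v \<eta> w) = int (\<xi> w) - laplacian (f(v := f v + 1)) w"
  using assms by (auto simp: topple_def laplacian_fun_upd)

text \<open>The least action principle: a vertex that has already toppled \<open>B v\<close> times cannot be
  unstable as long as no other vertex \<open>w\<close> has toppled more than \<open>B w\<close> times.\<close>

lemma least_action:
  assumes "\<And>v. v \<in> nonsink G \<Longrightarrow> 0 \<le> B v"
    and B: "\<And>v. v \<in> nonsink G \<Longrightarrow> int (\<xi> v) - laplacian B v < int (deg G v)"
  obtains \<sigma> f where "(topple_step G)\<^sup>*\<^sup>* \<xi> \<sigma>" "stable G \<sigma>"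
    "\<And>v. v \<in> nonsink G \<Longrightarrow> int (\<sigma> v) = int (\<xi> v) - laplacian f v"
    "\<And>v. v \<in> nonsink G \<Longrightarrow> f v \<le> B v"
proof -
  have "\<exists>\<sigma> f. (topple_step G)\<^sup>*\<^sup>* \<eta> \<sigma> \<and> stable G \<sigma> \<and>
      (\<forall>v\<in>nonsink G. int (\<sigma> v) = int (\<xi> v) - laplacian f v) \<and> (\<forall>v\<in>nonsink G. f v \<le> B v)"
    if "\<And>v. v \<in> nonsink G \<Longrightarrow> int (\<eta> v) = int (\<xi> v) - laplacian g v"
      "\<And>v. v \<in> nonsink G \<Longrightarrow> g v \<le> B v" for \<eta> g
    using that
  \<comment> \<open>The measure counts the topplings that \<open>B\<close> still allows; every
    toppling lowers it.\<close>
  proof (induction "nat (\<Sum>v\<in>nonsink G. B v - g v)" arbitrary: \<eta> g rule: less_induct)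
    case less
    show ?case
    proof (cases "stable G \<eta>")
      case True
      then show ?thesis using less.prems by blast
    next
      case False
      then obtain v where v: "v \<in> nonsink G" "deg G v \<le> \<eta> v"
        by (auto simp: stable_def not_less)
      have "g v \<noteq> B v"
      proof
        assume "g v = B v"
        then have "laplacian B v \<le> laplacian g v"
          using less.prems(2) by (rule laplacian_mono_at)
        with v less.prems(1)[of v] B[of v] show False by simp
      qed
      then have lt: "g v < B v" using less.prems(2)[of v] v by simp
      let ?g = "g(v := g v + 1)"
      have le: "?g w \<le> B w" if "w \<in> nonsink G" for w
        using less.prems(2)[OF that] lt by auto
      have "(\<Sum>w\<in>nonsink G. B w - ?g w) < (\<Sum>w\<in>nonsink G. B w - g w)"
        by (rule sum_strict_mono_ex1) (use finite_nonsink v in auto)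
      moreover have "0 \<le> (\<Sum>w\<in>nonsink G. B w - ?g w)"
        by (rule sum_nonneg) (use le in auto)
      ultimately have "nat (\<Sum>w\<in>nonsink G. B w - ?g w) < nat (\<Sum>w\<in>nonsink G. B w - g w)"
        by linarith
      from less.hyps[OF this topple_laplacian[OF v _ less.prems(1)] le]
      obtain \<sigma> f where *: "(topple_step G)\<^sup>*\<^sup>* (topple G v \<eta>) \<sigma>" "stable G \<sigma>"
        "\<forall>v\<in>nonsink G. int (\<sigma> v) = int (\<xi> v) - laplacian f v" "\<forall>v\<in>nonsink G. f v \<le> B v"
        by blast
      have "topple_step G \<eta> (topple G v \<eta>)" using v by (auto simp: topple_step_def)
      with * show ?thesis by (meson converse_rtranclp_into_rtranclp)
    qed
  qed
  from this[of \<xi> "\<lambda>_. 0"] assms(1) show ?thesis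
    using that by (auto simp: laplacian_def)
qed

section \<open>Confluence of toppling and uniqueness of the stabilization\<close>

lemma topple_step_diamond:
  assumes "topple_step G \<eta> \<alpha>" "topple_step G \<eta> \<beta>"
  shows "\<alpha> = \<beta> \<or> (\<exists>\<gamma>. topple_step G \<alpha> \<gamma> \<and> topple_step G \<beta> \<gamma>)"
proof -
  obtain v w where v: "v \<in> nonsink G" "deg G v \<le> \<eta> v" "\<alpha> = topple G v \<eta>"
    and w: "w \<in> nonsink G" "deg G w \<le> \<eta> w" "\<beta> = topple G w \<eta>"
    using assms by (auto simp: topple_step_def)
  show ?thesis
  proof (cases "v = w")
    case False
    \<comment> \<open>Toppling one of the two vertices takes no chips from the other, which
      therefore stays unstable; the changes to the chip counts commute.\<close>
    have "topple G w \<alpha> = topple G v \<beta>"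
      using v w False by (auto simp: topple_def fun_eq_iff)
    moreover have "deg G w \<le> \<alpha> w" "deg G v \<le> \<beta> v"
      using v w False by (auto simp: topple_def)
    ultimately show ?thesis using v w unfolding topple_step_def by metis
  qed (use v w in simp)
qed

lemma stable_no_step: "stable G \<sigma> \<Longrightarrow> \<not> topple_step G \<sigma> \<tau>"
  by (auto simp: stable_def topple_step_def not_le)

text \<open>The diamond moves the deviating step past the first step of the given path; at the end
  of the path a stable configuration admits no step, so the deviation must have merged with the
  path.\<close>

lemma step_to_stable:
  assumes "(topple_step G)\<^sup>*\<^sup>* \<eta> \<sigma>" "stable G \<sigma>" "topple_step G \<eta> \<alpha>"
  shows "(topple_step G)\<^sup>*\<^sup>* \<alpha> \<sigma>"
  using assms
proof (induction arbitrary: \<alpha> rule: converse_rtranclp_induct)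
  case base
  then show ?case using stable_no_step by blast
next
  case (step \<eta> \<beta>)
  then show ?case
    using topple_step_diamond[OF step.hyps(1) step.prems(2)]
    by (metis converse_rtranclp_into_rtranclp)
qed

lemma steps_to_stable:
  assumes "(topple_step G)\<^sup>*\<^sup>* \<eta> \<alpha>" "(topple_step G)\<^sup>*\<^sup>* \<eta> \<sigma>" "stable G \<sigma>"
  shows "(topple_step G)\<^sup>*\<^sup>* \<alpha> \<sigma>"
  using assms by (induction rule: rtranclp_induct) (auto intro: step_to_stable)

text \<open>Justifies the definite description: two stable results would be joined by topplings, and
  a stable configuration admits none.\<close>

lemma stabilize_eqI:
  assumes "(topple_step G)\<^sup>*\<^sup>* \<eta> \<sigma>" "stable G \<sigma>"
  shows "stabilize G \<eta> = \<sigma>"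
  unfolding stabilize_def
proof (rule the_equality)
  fix \<tau> assume \<tau>: "(topple_step G)\<^sup>*\<^sup>* \<eta> \<tau> \<and> stable G \<tau>"
  then have "(topple_step G)\<^sup>*\<^sup>* \<tau> \<sigma>" using assms steps_to_stable by blast
  then show "\<tau> = \<sigma>"
    using \<tau> stable_no_step by (metis converse_rtranclpE)
qed (use assms in simp)

lemma stabilize_stable: "stable G \<sigma> \<Longrightarrow> stabilize G \<sigma> = \<sigma>"
  by (rule stabilize_eqI) auto

section \<open>Compatibility of toppling with addition\<close>

lemma config_add_assoc: "config_add (config_add \<eta> \<xi>) \<zeta> = config_add \<eta> (config_add \<xi> \<zeta>)"
  by (simp add: config_add_def add.assoc)

lemma config_add_commute: "config_add \<eta> \<xi> = config_add \<xi> \<eta>"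
  by (simp add: config_add_def add.commute)

lemma config_add_configs: "\<eta> \<in> configs G \<Longrightarrow> \<xi> \<in> configs G \<Longrightarrow> config_add \<eta> \<xi> \<in> configs G"
  by (simp add: configs_def config_add_def)

text \<open>Extra chips keep a legal toppling legal.\<close>

lemma topple_step_config_add:
  "topple_step G \<eta> \<eta>' \<Longrightarrow> topple_step G (config_add \<eta> \<xi>) (config_add \<eta>' \<xi>)"
  by (fastforce simp: topple_step_def topple_def config_add_def fun_eq_iff)

lemma steps_config_add:
  "(topple_step G)\<^sup>*\<^sup>* \<eta> \<eta>' \<Longrightarrow> (topple_step G)\<^sup>*\<^sup>* (config_add \<eta> \<xi>) (config_add \<eta>' \<xi>)"
  by (induction rule: rtranclp_induct)
    (auto intro: rtranclp.rtrancl_into_rtrancl topple_step_config_add)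

lemma steps_configs: "(topple_step G)\<^sup>*\<^sup>* \<eta> \<eta>' \<Longrightarrow> \<eta> \<in> configs G \<Longrightarrow> \<eta>' \<in> configs G"
  by (induction rule: rtranclp_induct) (auto simp: configs_def topple_step_def topple_def)

end

section \<open>The maximal stable configuration as identity\<close>

definition max_stable :: "'v sink_graph \<Rightarrow> 'v \<Rightarrow> nat" where
  "max_stable G = (\<lambda>v. if v \<in> nonsink G then deg G v - 1 else 0)"

text \<open>The degree bound makes \<open>max_stable\<close> strictly positive, so that
  \<open>u\<close> has a strictly positive Laplacian, as the maximum principle needs for
  \<open>- u\<close>.\<close>

locale sandpile_potential = sandpile +
  fixes u :: "'a \<Rightarrow> int"
  assumes deg_ge_2: "v \<in> nonsink G \<Longrightarrow> 2 \<le> deg G v"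
    and laplacian_u: "v \<in> nonsink G \<Longrightarrow> laplacian u v = int (max_stable G v)"
begin

lemma max_stable_pos: "v \<in> nonsink G \<Longrightarrow> 0 < max_stable G v"
  using deg_ge_2[of v] by (simp add: max_stable_def)

lemma max_stable_configs: "max_stable G \<in> configs G"
  by (simp add: max_stable_def configs_def)

lemma stable_iff_le: "stable G \<sigma> \<longleftrightarrow> (\<forall>v\<in>nonsink G. \<sigma> v \<le> max_stable G v)"
proof -
  have "\<sigma> v < deg G v \<longleftrightarrow> \<sigma> v \<le> max_stable G v" if "v \<in> nonsink G" for v
    using deg_ge_2[OF that] that by (auto simp: max_stable_def)
  then show ?thesis by (simp add: stable_def)
qed

lemma u_nonneg:
  assumes "v \<in> nonsink G"
  shows "0 \<le> u v"
proof -
  have "laplacian (\<lambda>v. (- 1) * u v) w < 0" if "w \<in> nonsink G" for w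
    using laplacian_u[OF that] max_stable_pos[OF that] unfolding laplacian_cmult by simp
  from maximum_principle[OF this assms] show ?thesis by simp
qed

lemma ex_stabilization:
  obtains \<sigma> where "(topple_step G)\<^sup>*\<^sup>* \<xi> \<sigma>" "stable G \<sigma>"
proof -
  \<comment> \<open>The total number of chips bounds each \<open>\<xi> v\<close>. As
    \<open>laplacian u\<close> is at least 1, toppling according to \<open>N * u\<close> leaves at
    most 0 chips everywhere, so \<open>N * u\<close> can serve as the bound in
    \<open>least_action\<close>.\<close>
  define N where "N = (\<Sum>v\<in>nonsink G. int (\<xi> v))"
  have N: "int (\<xi> v) \<le> N" if "v \<in> nonsink G" for v
    unfolding N_def by (rule member_le_sum) (use that finite_nonsink in auto)
  have "0 \<le> N" by (simp add: N_def sum_nonneg)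
  have bound: "int (\<xi> v) - laplacian (\<lambda>v. N * u v) v < int (deg G v)" if v: "v \<in> nonsink G" for v
  proof -
    have "N * 1 \<le> N * laplacian u v"
      using \<open>0 \<le> N\<close> max_stable_pos[OF v] laplacian_u[OF v] by (intro mult_left_mono) auto
    then show ?thesis
      using N[OF v] deg_ge_2[OF v] by (simp add: laplacian_cmult)
  qed
  have "0 \<le> N * u v" if "v \<in> nonsink G" for v
    using u_nonneg[OF that] \<open>0 \<le> N\<close> by simp
  from least_action[OF this bound] that show ?thesis by metis
qed

lemma stabilize_steps: "(topple_step G)\<^sup>*\<^sup>* \<eta> (stabilize G \<eta>)"
  and stable_stabilize: "stable G (stabilize G \<eta>)"
  using ex_stabilization stabilize_eqI by metis+

lemma stabilize_configs: "\<eta> \<in> configs G \<Longrightarrow> stabilize G \<eta> \<in> configs G"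
  using stabilize_steps steps_configs by blast

text \<open>Stabilizing one summand first performs topplings that are also legal in the sum.\<close>

lemma stabilize_add_left: "stabilize G (config_add (stabilize G \<eta>) \<xi>) = stabilize G (config_add \<eta> \<xi>)"
proof -
  have "(topple_step G)\<^sup>*\<^sup>* (config_add \<eta> \<xi>) (config_add (stabilize G \<eta>) \<xi>)"
    by (rule steps_config_add[OF stabilize_steps])
  then show ?thesis
    using stabilize_eqI[OF rtranclp_trans[OF _ stabilize_steps] stable_stabilize] by metis
qed

lemma stabilize_add_right: "stabilize G (config_add \<xi> (stabilize G \<eta>)) = stabilize G (config_add \<xi> \<eta>)"
  by (metis config_add_commute stabilize_add_left)

lemma max_stable_idem: "stabilize G (config_add (max_stable G) (max_stable G)) = max_stable G"
proof -
  let ?m = "max_stable G" and ?mm = "config_add (max_stable G) (max_stable G)"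
  \<comment> \<open>Toppling according to \<open>u\<close> turns twice \<open>?m\<close> into
    \<open>?m\<close>, which is stable, so \<open>u\<close> bounds the odometer
    \<open>f\<close>.\<close>
  have "int (?mm v) - laplacian u v < int (deg G v)" if "v \<in> nonsink G" for v
    using laplacian_u[OF that] deg_ge_2[OF that] that by (simp add: config_add_def max_stable_def)
  from least_action[OF u_nonneg this] obtain \<sigma> f where steps: "(topple_step G)\<^sup>*\<^sup>* ?mm \<sigma>"
    and stab: "stable G \<sigma>"
    and \<sigma>: "\<And>v. v \<in> nonsink G \<Longrightarrow> int (\<sigma> v) = int (?mm v) - laplacian f v"
    and f: "\<And>v. v \<in> nonsink G \<Longrightarrow> f v \<le> u v"
    by metis
  \<comment> \<open>Stability of \<open>\<sigma>\<close> means that \<open>f\<close> removes at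
    least \<open>?m\<close> from twice \<open>?m\<close>.\<close>
  have le: "laplacian u v \<le> laplacian f v" if "v \<in> nonsink G" for v
    using stab \<sigma>[OF that] laplacian_u[OF that] that by (auto simp: stable_iff_le config_add_def)
  have eq: "f x = u x" if x: "x \<in> nonsink G" for x
  proof (rule ccontr)
    assume "f x \<noteq> u x"
    then have "1 \<le> u x - f x" using f[OF x] by simp
    \<comment> \<open>The Laplacian of \<open>u - f\<close> is only known to be at most 0;
      subtracting \<open>u\<close> makes it strictly negative. The factor \<open>N\<close>, larger
      than \<open>u x\<close>, lets an integer gap of 1 at \<open>x\<close> outweigh the subtracted
      \<open>u x\<close>.\<close>
    define N where "N = u x + 1"
    have "0 \<le> N" using u_nonneg[OF x] by (simp add: N_def)
    have "laplacian (\<lambda>v. N * (u v - f v) - u v) v < 0" if v: "v \<in> nonsink G" for v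
    proof -
      have "N * (laplacian u v - laplacian f v) \<le> 0"
        using \<open>0 \<le> N\<close> le[OF v] by (simp add: mult_nonneg_nonpos)
      then show ?thesis
        using laplacian_u[OF v] max_stable_pos[OF v]
        by (simp add: laplacian_diff laplacian_cmult)
    qed
    from maximum_principle[OF this x] have "N * (u x - f x) \<le> u x" by simp
    moreover have "N * 1 \<le> N * (u x - f x)"
      using \<open>0 \<le> N\<close> \<open>1 \<le> u x - f x\<close> by (rule mult_left_mono[rotated])
    ultimately show False by (simp add: N_def)
  qed
  have "\<sigma> = ?m"
  proof
    fix v
    show "\<sigma> v = ?m v"
    proof (cases "v \<in> nonsink G")
      case True
      have "laplacian f v = laplacian u v"
        using eq True by (auto simp: laplacian_def)
      then show ?thesis using \<sigma>[OF True] laplacian_u[OF True] by (simp add: config_add_def)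
    next
      case False
      have "\<sigma> \<in> configs G"
        using steps steps_configs config_add_configs max_stable_configs by blast
      then show ?thesis using False by (simp add: configs_def max_stable_def)
    qed
  qed
  then show ?thesis using stabilize_eqI steps stab by simp
qed

section \<open>Recurrent configurations and the group axioms\<close>

lemma recurrent_max_stable: "recurrent G (max_stable G)"
proof -
  have "\<exists>\<eta>'\<in>configs G. max_stable G = stabilize G (config_add \<eta> \<eta>')" if "\<eta> \<in> configs G" for \<eta>
  proof
    \<comment> \<open>Stabilize \<open>\<eta>\<close> first, then fill every vertex up to the
      maximum. Stability makes this subtraction exact.\<close>
    let ?\<eta>' = "\<lambda>v. max_stable G v - stabilize G \<eta> v"
    show "?\<eta>' \<in> configs G" using max_stable_configs by (simp add: configs_def)
    have "stabilize G \<eta> v \<le> max_stable G v" for v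
      using stable_stabilize[of \<eta>] stabilize_configs[OF that]
      by (cases "v \<in> nonsink G") (auto simp: stable_iff_le configs_def)
    then have "config_add (stabilize G \<eta>) ?\<eta>' = max_stable G"
      by (simp add: config_add_def)
    then show "max_stable G = stabilize G (config_add \<eta> ?\<eta>')"
      using stabilize_add_left[of \<eta> ?\<eta>'] stabilize_stable[of "max_stable G"]
      by (simp add: stable_iff_le)
  qed
  then show ?thesis by (simp add: recurrent_def max_stable_configs stable_iff_le)
qed

text \<open>From any \<open>\<eta>\<close> one can first reach \<open>\<sigma>\<close> and then add
  \<open>\<xi>\<close>.\<close>

lemma recurrent_stabilize_add:
  assumes "recurrent G \<sigma>" "\<xi> \<in> configs G"
  shows "recurrent G (stabilize G (config_add \<sigma> \<xi>))"
  unfolding recurrent_def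
proof (intro conjI ballI)
  show "stabilize G (config_add \<sigma> \<xi>) \<in> configs G"
    using assms by (simp add: recurrent_def stabilize_configs config_add_configs)
  show "stable G (stabilize G (config_add \<sigma> \<xi>))" by (rule stable_stabilize)
  fix \<eta> assume "\<eta> \<in> configs G"
  then obtain \<eta>' where \<eta>': "\<eta>' \<in> configs G" "\<sigma> = stabilize G (config_add \<eta> \<eta>')"
    using assms by (auto simp: recurrent_def)
  then have "stabilize G (config_add \<sigma> \<xi>) = stabilize G (config_add \<eta> (config_add \<eta>' \<xi>))"
    by (simp add: stabilize_add_left config_add_assoc)
  then show "\<exists>\<eta>'\<in>configs G. stabilize G (config_add \<sigma> \<xi>) = stabilize G (config_add \<eta> \<eta>')"
    using \<eta>' assms(2) config_add_configs by blast
qed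

lemma sandpile_add_commute: "sandpile_add G \<sigma> \<tau> = sandpile_add G \<tau> \<sigma>"
  by (simp add: sandpile_add_def config_add_commute)

text \<open>Recurrence exhibits \<open>\<sigma>\<close> as a stabilization of the maximal
  configuration plus chips, where a second maximal summand is absorbed by idempotence.\<close>

lemma sandpile_add_max_stable:
  assumes "recurrent G \<sigma>"
  shows "sandpile_add G (max_stable G) \<sigma> = \<sigma>"
proof -
  let ?m = "max_stable G"
  obtain \<eta> where \<eta>: "\<sigma> = stabilize G (config_add ?m \<eta>)"
    using assms max_stable_configs by (auto simp: recurrent_def)
  have "sandpile_add G ?m \<sigma> = stabilize G (config_add (config_add ?m ?m) \<eta>)"
    by (simp add: sandpile_add_def \<eta> stabilize_add_right config_add_assoc)
  also have "\<dots> = stabilize G (config_add (stabilize G (config_add ?m ?m)) \<eta>)"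
    by (simp only: stabilize_add_left)
  also have "\<dots> = \<sigma>" by (simp add: max_stable_idem \<eta>)
  finally show ?thesis .
qed

lemma sandpile_group_one: "\<one>\<^bsub>sandpile_group G\<^esub> = max_stable G"
proof -
  have "(THE e. recurrent G e \<and>
      (\<forall>\<sigma>. recurrent G \<sigma> \<longrightarrow> sandpile_add G e \<sigma> = \<sigma> \<and> sandpile_add G \<sigma> e = \<sigma>)) = max_stable G"
  proof (rule the_equality)
    show "recurrent G (max_stable G) \<and> (\<forall>\<sigma>. recurrent G \<sigma> \<longrightarrow>
        sandpile_add G (max_stable G) \<sigma> = \<sigma> \<and> sandpile_add G \<sigma> (max_stable G) = \<sigma>)"
      using recurrent_max_stable sandpile_add_max_stable sandpile_add_commute by metis
  \<comment> \<open>For another identity \<open>e\<close>, its sum with \<open>max_stable G\<close>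
    equals both.\<close>
  qed (metis recurrent_max_stable sandpile_add_max_stable)
  then show ?thesis by (simp add: sandpile_group_def)
qed

lemma group_sandpile_group: "group (sandpile_group G)"
proof (rule groupI)
  show "\<one>\<^bsub>sandpile_group G\<^esub> \<in> carrier (sandpile_group G)"
    unfolding sandpile_group_one by (simp add: sandpile_group_def recurrent_max_stable)
next
  fix \<sigma> \<tau> assume "\<sigma> \<in> carrier (sandpile_group G)" "\<tau> \<in> carrier (sandpile_group G)"
  then show "\<sigma> \<otimes>\<^bsub>sandpile_group G\<^esub> \<tau> \<in> carrier (sandpile_group G)"
    using recurrent_stabilize_add[of \<sigma> \<tau>]
    by (simp add: sandpile_group_def sandpile_add_def recurrent_def)
next
  fix \<sigma> \<tau> \<rho>
  show "\<sigma> \<otimes>\<^bsub>sandpile_group G\<^esub> \<tau> \<otimes>\<^bsub>sandpile_group G\<^esub> \<rho> =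
      \<sigma> \<otimes>\<^bsub>sandpile_group G\<^esub> (\<tau> \<otimes>\<^bsub>sandpile_group G\<^esub> \<rho>)"
    by (simp add: sandpile_group_def sandpile_add_def stabilize_add_left stabilize_add_right
        config_add_assoc)
next
  fix \<sigma> assume "\<sigma> \<in> carrier (sandpile_group G)"
  then show "\<one>\<^bsub>sandpile_group G\<^esub> \<otimes>\<^bsub>sandpile_group G\<^esub> \<sigma> = \<sigma>"
    unfolding sandpile_group_one by (simp add: sandpile_group_def sandpile_add_max_stable)
next
  let ?m = "max_stable G"
  fix \<sigma> assume "\<sigma> \<in> carrier (sandpile_group G)"
  then have "recurrent G \<sigma>" by (simp add: sandpile_group_def)
  then obtain \<eta> where \<eta>: "\<eta> \<in> configs G" "?m = stabilize G (config_add \<sigma> \<eta>)"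
    using recurrent_max_stable by (auto simp: recurrent_def)
  \<comment> \<open>The complement \<open>\<eta>\<close> of \<open>\<sigma>\<close> need not be
    recurrent; adding \<open>?m\<close> makes it so without changing the sum with
    \<open>\<sigma>\<close>, by idempotence of \<open>?m\<close>.\<close>
  let ?\<tau> = "stabilize G (config_add ?m \<eta>)"
  have "recurrent G ?\<tau>" by (rule recurrent_stabilize_add[OF recurrent_max_stable \<eta>(1)])
  moreover have "sandpile_add G ?\<tau> \<sigma> = ?m"
  proof -
    have "sandpile_add G ?\<tau> \<sigma> = stabilize G (config_add ?m (config_add \<sigma> \<eta>))"
      by (simp add: sandpile_add_def stabilize_add_left config_add_assoc config_add_commute[of \<eta>])
    also have "\<dots> = stabilize G (config_add ?m (stabilize G (config_add \<sigma> \<eta>)))"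
      by (simp only: stabilize_add_right)
    also have "\<dots> = ?m" by (simp add: \<eta>(2)[symmetric] max_stable_idem)
    finally show ?thesis .
  qed
  ultimately show "\<exists>\<tau>\<in>carrier (sandpile_group G). \<tau> \<otimes>\<^bsub>sandpile_group G\<^esub> \<sigma> = \<one>\<^bsub>sandpile_group G\<^esub>"
    unfolding sandpile_group_one by (auto simp: sandpile_group_def)
qed

end

section \<open>The potential on the cell graph\<close>

lemma finite_words: "finite (words n)"
proof -
  have "words n = {w. set w \<subseteq> {0, 1, 2} \<and> length w = n}" by (auto simp: words_def)
  then show ?thesis by (simp add: finite_lists_length_eq)
qed

lemma cell_adj_words: "cell_adj n u v \<Longrightarrow> u \<in> words n \<and> v \<in> words n"
  by (simp add: cell_adj_def)

lemma finite_cell_nbrs: "finite {v. cell_adj n u v}"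
  by (rule finite_subset[OF _ finite_words[of n]]) (auto simp: cell_adj_def)

lemma cell_adj_sym: "cell_adj n u v \<Longrightarrow> cell_adj n v u"
  unfolding cell_adj_def by metis

lemma cell_adj_irrefl: "\<not> cell_adj n u u"
  by (auto simp: cell_adj_def)

lemma cell_adj_0: "\<not> cell_adj 0 u v"
  by (auto simp: cell_adj_def words_def)

lemma Cons_words: "c # u \<in> words (Suc k) \<longleftrightarrow> c \<in> {0, 1, 2} \<and> u \<in> words k"
  by (auto simp: words_def)

lemma replicate_words: "d \<in> {0, 1, 2} \<Longrightarrow> replicate k d \<in> words k"
  by (auto simp: words_def)

text \<open>Three copies of the level \<open>k\<close> graph, one per first letter, joined pairwise
  by one edge between corners. The cases correspond to a nonempty or empty common prefix in
  \<open>cell_adj\<close>.\<close>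

lemma cell_adj_Cons:
  assumes "c # u \<in> words (Suc k)"
  shows "cell_adj (Suc k) (c # u) (d # v) \<longleftrightarrow>
    (if d = c then cell_adj k u v
     else d \<in> {0, 1, 2} \<and> u = replicate k d \<and> v = replicate k c)"
proof
  assume "cell_adj (Suc k) (c # u) (d # v)"
  then obtain w i j l where *: "d # v \<in> words (Suc k)" "i \<noteq> j"
    "c # u = w @ i # replicate l j" "d # v = w @ j # replicate l i"
    by (auto simp: cell_adj_def)
  show "if d = c then cell_adj k u v
     else d \<in> {0, 1, 2} \<and> u = replicate k d \<and> v = replicate k c"
  proof (cases w)
    case Nil
    with * assms show ?thesis by (auto simp: Cons_words words_def)
  next
    case (Cons x w')
    with * assms show ?thesis by (auto simp: Cons_words cell_adj_def)
  qed
next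
  assume R: "if d = c then cell_adj k u v
     else d \<in> {0, 1, 2} \<and> u = replicate k d \<and> v = replicate k c"
  show "cell_adj (Suc k) (c # u) (d # v)"
  proof (cases "d = c")
    case True
    with R obtain w i j l where *: "v \<in> words k" "i \<noteq> j"
      "u = w @ i # replicate l j" "v = w @ j # replicate l i"
      by (auto simp: cell_adj_def)
    then have "c # u = (c # w) @ i # replicate l j \<and> d # v = (c # w) @ j # replicate l i"
      using True by simp
    then show ?thesis
      using * assms True unfolding cell_adj_def Cons_words by blast
  next
    case False
    then have "c # u = [] @ c # replicate k d \<and> d # v = [] @ d # replicate k c"
      using R by simp
    moreover have "d # v \<in> words (Suc k)"
      using R False assms by (simp add: Cons_words replicate_words)
    ultimately show ?thesis using assms False unfolding cell_adj_def by metis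
  qed
qed

lemma cell_nbrs_Cons:
  assumes "c # u \<in> words (Suc k)"
  shows "{v. cell_adj (Suc k) (c # u) v} = (#) c ` {v. cell_adj k u v} \<union>
    (\<lambda>d. d # replicate k c) ` {d \<in> {0, 1, 2} - {c}. u = replicate k d}" (is "?A = ?B")
proof (rule Set.set_eqI)
  fix v
  show "v \<in> ?A \<longleftrightarrow> v \<in> ?B"
  proof (cases v)
    case Nil
    then show ?thesis by (auto simp: cell_adj_def words_def)
  next
    case (Cons d v')
    then show ?thesis using cell_adj_Cons[OF assms] by auto
  qed
qed

text \<open>Separates edges inside a subcell from junctions. Summing over letters also covers
  \<open>k = 0\<close>, where the empty word is every corner at once.\<close>

lemma sum_cell_nbrs_Cons:
  fixes g :: "nat list \<Rightarrow> int"
  assumes "c # u \<in> words (Suc k)"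
  shows "(\<Sum>v | cell_adj (Suc k) (c # u) v. g v) = (\<Sum>v | cell_adj k u v. g (c # v)) +
    (\<Sum>d\<in>{0, 1, 2} - {c}. if u = replicate k d then g (d # replicate k c) else 0)"
proof -
  have "(\<Sum>v | cell_adj (Suc k) (c # u) v. g v) = sum g ((#) c ` {v. cell_adj k u v}) +
      sum g ((\<lambda>d. d # replicate k c) ` {d \<in> {0, 1, 2} - {c}. u = replicate k d})"
    unfolding cell_nbrs_Cons[OF assms]
    by (rule sum.union_disjoint) (auto simp: finite_cell_nbrs)
  also have "sum g ((#) c ` {v. cell_adj k u v}) = (\<Sum>v | cell_adj k u v. g (c # v))"
    by (subst sum.reindex) auto
  also have "sum g ((\<lambda>d. d # replicate k c) ` {d \<in> {0, 1, 2} - {c}. u = replicate k d}) =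
      (\<Sum>d | d \<in> {0, 1, 2} - {c} \<and> u = replicate k d. g (d # replicate k c))"
    by (subst sum.reindex) (auto simp: inj_on_def)
  also have "\<dots> = (\<Sum>d\<in>{0, 1, 2} - {c}. if u = replicate k d then g (d # replicate k c) else 0)"
    by (rule sum.inter_filter) simp
  finally show ?thesis .
qed

lemma sum_letters_remove:
  fixes h :: "nat \<Rightarrow> int"
  assumes "c \<in> {0, 1, 2}"
  shows "(\<Sum>d\<in>{0, 1, 2}. h d) = h c + (\<Sum>d\<in>{0, 1, 2} - {c}. h d)"
  using assms by (intro sum.remove) auto

text \<open>Counting corners with multiplicity gives 0 for the empty word, which starts the
  induction; then each junction restores an edge missing at a corner of a subcell.\<close>

lemma card_cell_nbrs:
  "u \<in> words k \<Longrightarrow>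
    int (card {v. cell_adj k u v}) = 3 - (\<Sum>c\<in>{0, 1, 2}. if u = replicate k c then 1 else 0)"
proof (induction u arbitrary: k)
  case Nil
  then have "k = 0" by (simp add: words_def)
  then show ?case by (simp add: cell_adj_0)
next
  case (Cons c u)
  then obtain j where k: "k = Suc j" by (cases k) (auto simp: words_def)
  then have c: "c \<in> {0, 1, 2}" and u: "u \<in> words j" using Cons.prems Cons_words by auto
  have "int (card {v. cell_adj k (c # u) v}) = (\<Sum>v | cell_adj k (c # u) v. 1)" by simp
  also have "\<dots> = int (card {v. cell_adj j u v}) +
      (\<Sum>d\<in>{0, 1, 2} - {c}. if u = replicate j d then 1 else 0)"
    unfolding k using Cons.prems by (subst sum_cell_nbrs_Cons) (simp_all add: k)
  also have "\<dots> = 3 - (if u = replicate j c then 1 else 0)"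
    unfolding Cons.IH[OF u] sum_letters_remove[OF c] by simp
  also have "(if u = replicate j c then 1 else 0) =
      (\<Sum>d\<in>{0, 1, 2}. if c # u = replicate k d then 1 else (0 :: int))"
    unfolding sum_letters_remove[OF c] by (auto simp: k intro!: sum.neutral)
  finally show ?case .
qed

section \<open>The Neumann flow and the potential\<close>

text \<open>The flow of a solution of the Neumann problem through the corners of a cell of level \<open>k\<close>
  is \<open>2 * 3 ^ k * t c\<close> at the corner \<open>c\<close>. By symmetry the junction between subcells \<open>c\<close> and \<open>d\<close>
  carries a third of the difference of the flows at the corners \<open>c\<close> and \<open>d\<close>, hence \<open>subflow\<close>.\<close>

definition subflow :: "nat \<Rightarrow> (nat \<Rightarrow> int) \<Rightarrow> nat \<Rightarrow> int" where
  "subflow c t = (\<lambda>d. if d = c then 3 * t c else t d - t c)"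

text \<open>The offset \<open>2 * 5 ^ length w * t c\<close> of subcell \<open>c\<close> is fitted
  so that the jump across each junction equals the flow it must carry.\<close>

primrec drop_of :: "(nat \<Rightarrow> int) \<Rightarrow> nat list \<Rightarrow> int" where
  "drop_of t [] = 0"
| "drop_of t (c # w) = 2 * 5 ^ length w * t c + drop_of (subflow c t) w"

text \<open>Towards the corner the flow parameter triples at each level, so the coefficient
  \<open>a k\<close> satisfies \<open>a (k + 1) = 2 * 5 ^ k + 3 * a k\<close>.\<close>

lemma drop_of_replicate: "drop_of t (replicate k c) = (5 ^ k - 3 ^ k) * t c"
proof (induction k arbitrary: t)
  case (Suc k)
  have "drop_of t (replicate (Suc k) c) = 2 * 5 ^ k * t c + (5 ^ k - 3 ^ k) * subflow c t c"
    by (simp add: Suc.IH)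
  then show ?case by (simp add: subflow_def algebra_simps)
qed simp

lemma drop_of_dvd: "(\<And>c. m dvd t c) \<Longrightarrow> m dvd drop_of t w"
  by (induction w arbitrary: t) (auto simp: subflow_def)

text \<open>Inside subcell \<open>c\<close> the induction hypothesis holds for
  \<open>subflow c t\<close>; its corner terms at the junctions cancel against the junction edges,
  leaving only the outer corner.\<close>

lemma drop_of_neumann:
  "w \<in> words k \<Longrightarrow> (\<Sum>v | cell_adj k w v. drop_of t v - drop_of t w) =
    2 * (\<Sum>c\<in>{0, 1, 2}. t c) - (\<Sum>c\<in>{0, 1, 2}. if w = replicate k c then 2 * 3 ^ k * t c else 0)"
proof (induction w arbitrary: k t)
  case Nil
  then have "k = 0" by (simp add: words_def)
  then show ?case by (simp add: cell_adj_0)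
next
  case (Cons c w)
  then obtain j where k: "k = Suc j" by (cases k) (auto simp: words_def)
  then have c: "c \<in> {0, 1, 2}" and w: "w \<in> words j" using Cons.prems Cons_words by auto
  let ?t = "subflow c t"
  have len: "length v = j" if "cell_adj j w v" for v
    using that by (auto simp: cell_adj_def words_def)
  have "(\<Sum>v | cell_adj k (c # w) v. drop_of t v - drop_of t (c # w)) =
      (\<Sum>v | cell_adj j w v. drop_of t (c # v) - drop_of t (c # w)) +
      (\<Sum>d\<in>{0, 1, 2} - {c}. if w = replicate j d
        then drop_of t (d # replicate j c) - drop_of t (c # w) else 0)"
    unfolding k by (rule sum_cell_nbrs_Cons) (use Cons.prems k in simp)
  also have "(\<Sum>v | cell_adj j w v. drop_of t (c # v) - drop_of t (c # w)) =
      (\<Sum>v | cell_adj j w v. drop_of ?t v - drop_of ?t w)"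
    using w by (intro sum.cong) (auto simp: len words_def)
  also have "\<dots> = 2 * (\<Sum>d\<in>{0, 1, 2}. ?t d) -
      (\<Sum>d\<in>{0, 1, 2}. if w = replicate j d then 2 * 3 ^ j * ?t d else 0)"
    by (rule Cons.IH[OF w])
  also have "(\<Sum>d\<in>{0, 1, 2} - {c}. if w = replicate j d
        then drop_of t (d # replicate j c) - drop_of t (c # w) else 0) =
      (\<Sum>d\<in>{0, 1, 2} - {c}. if w = replicate j d then 2 * 3 ^ j * ?t d else 0)"
    by (intro sum.cong refl) (auto simp: drop_of_replicate subflow_def algebra_simps)
  \<comment> \<open>\<open>subflow\<close> preserves the total, so the source per vertex is the same
    on all levels.\<close>
  also have "(\<Sum>d\<in>{0, 1, 2}. ?t d) = (\<Sum>d\<in>{0, 1, 2}. t d)"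
    using c by (auto simp: subflow_def)
  also have "(\<Sum>d\<in>{0, 1, 2}. if w = replicate j d then 2 * 3 ^ j * ?t d else 0) =
      (\<Sum>d\<in>{0, 1, 2}. if c # w = replicate k d then 2 * 3 ^ k * t d else 0) +
      (\<Sum>d\<in>{0, 1, 2} - {c}. if w = replicate j d then 2 * 3 ^ j * ?t d else 0)"
  proof -
    have "(\<Sum>d\<in>{0, 1, 2} - {c}. if c # w = replicate k d then 2 * 3 ^ k * t d else 0) = 0"
      by (rule sum.neutral) (auto simp: k)
    then show ?thesis
      unfolding sum_letters_remove[OF c] by (auto simp: k subflow_def)
  qed
  finally show ?case by simp
qed

text \<open>The division is exact; the constant is chosen so that the corners get the
  value \<open>2 * 3 ^ (n - 1)\<close>, which is the flow through them into the sink.\<close>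

definition potential :: "nat \<Rightarrow> nat list \<Rightarrow> int" where
  "potential n w = (5 ^ n + 3 ^ n - drop_of (\<lambda>_. 1) w) div 3"

lemma three_potential:
  assumes "w \<in> words n" "n > 0"
  shows "3 * potential n w = 5 ^ n + 3 ^ n - drop_of (\<lambda>_. 1) w"
proof -
  obtain c v k where w: "w = c # v" "n = Suc k" "length v = k"
    using assms by (cases w; cases n) (auto simp: words_def)
  \<comment> \<open>The subflow of the constant 1 is 3 at \<open>c\<close> and 0 elsewhere.\<close>
  have "3 dvd drop_of (subflow c (\<lambda>_. 1)) v"
    by (rule drop_of_dvd) (simp add: subflow_def)
  then have "3 dvd 3 * (5 ^ k + 3 ^ k) - drop_of (subflow c (\<lambda>_. 1)) v"
    by (intro dvd_diff) auto
  also have "\<dots> = 5 ^ n + 3 ^ n - drop_of (\<lambda>_. 1) w"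
    by (simp add: w)
  finally show ?thesis by (simp add: potential_def)
qed

text \<open>For positive \<open>n\<close> the corners are distinct, so at most one term
  survives.\<close>

lemma sum_corners:
  fixes x :: int
  assumes "n > 0"
  shows "(\<Sum>c\<in>{0, 1, 2}. if w = replicate n c then x else 0) = (if w \<in> corners n then x else 0)"
  using assms by (auto simp: corners_def replicate_eq_replicate)

lemma potential_dirichlet:
  assumes "w \<in> words n" "n > 0"
  shows "3 * potential n w - (\<Sum>v | cell_adj n w v. potential n v) = 2"
proof -
  let ?N = "{v. cell_adj n w v}" and ?F = "drop_of (\<lambda>_. 1)"
  have N: "v \<in> words n" if "cell_adj n w v" for v
    using that by (simp add: cell_adj_def)
  have "(\<Sum>v\<in>?N. 3 * potential n w - 3 * potential n v) = (\<Sum>v\<in>?N. ?F v - ?F w)"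
    using assms N by (intro sum.cong) (auto simp: three_potential)
  also have "\<dots> = 6 - (if w \<in> corners n then 2 * 3 ^ n else 0)"
    using drop_of_neumann[OF assms(1), of "\<lambda>_. 1"] sum_corners[OF assms(2), of w "2 * 3 ^ n"]
    by simp
  \<comment> \<open>At a corner \<open>drop_of\<close> is \<open>5 ^ n - 3 ^ n\<close>, so the
    prescribed outflow is exactly what an edge to a sink at potential 0 carries.\<close>
  also have "(if w \<in> corners n then 2 * 3 ^ n else 0) =
      (if w \<in> corners n then 3 * potential n w else 0)"
    using three_potential[OF assms] by (auto simp: corners_def drop_of_replicate)
  finally have "int (card ?N) * (3 * potential n w) - 3 * (\<Sum>v\<in>?N. potential n v) =
      6 - (if w \<in> corners n then 3 * potential n w else 0)"
    by (simp add: sum_subtractf sum_distrib_left)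
  moreover have "int (card ?N) = 3 - (if w \<in> corners n then 1 else 0)"
    using card_cell_nbrs[OF assms(1)] sum_corners[OF assms(2), of w 1] by simp
  ultimately show ?thesis by (auto split: if_splits)
qed

section \<open>The sandpile on the cell graph\<close>

lemma nonsink_SGC: "nonsink (SGC n) = Some ` words n"
  by (auto simp: nonsink_def SGC_def)

lemma deg_SGC:
  assumes "w \<in> words n" "n > 0"
  shows "deg (SGC n) (Some w) = 3"
proof -
  have "{x \<in> verts (SGC n). adj (SGC n) (Some w) x} =
      Some ` {v. cell_adj n w v} \<union> (if w \<in> corners n then {None} else {})"
    by (auto simp: SGC_def dest: cell_adj_words)
  then have "deg (SGC n) (Some w) = card {v. cell_adj n w v} + (if w \<in> corners n then 1 else 0)"
    unfolding deg_def by (auto simp: card_image finite_cell_nbrs card_insert_if)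
  moreover have "int (card {v. cell_adj n w v}) = 3 - (if w \<in> corners n then 1 else 0)"
    using card_cell_nbrs[OF assms(1)] sum_corners[OF assms(2), of w 1] by simp
  ultimately show ?thesis by (auto split: if_splits)
qed

lemma sandpile_SGC: "sandpile (SGC n)"
proof
  show "finite (verts (SGC n))" by (simp add: SGC_def finite_words)
  show "\<not> adj (SGC n) v v" for v
    by (cases v) (auto simp: SGC_def cell_adj_irrefl)
  show "adj (SGC n) w v" if "adj (SGC n) v w" for v w
    using that by (cases v; cases w) (auto simp: SGC_def cell_adj_sym)
qed

lemma max_stable_SGC:
  assumes "n > 0"
  shows "max_stable (SGC n) = (\<lambda>v. if v \<in> nonsink (SGC n) then 2 else 0)"
  using assms by (auto simp: max_stable_def nonsink_SGC deg_SGC fun_eq_iff)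

text \<open>The value at \<open>the None\<close> is never consulted: the conditions concern non-sink
  vertices, and \<open>laplacian\<close> sums over non-sink neighbours.\<close>

lemma sandpile_potential_SGC:
  assumes "n > 0"
  shows "sandpile_potential (SGC n) (\<lambda>x. potential n (the x))"
proof -
  interpret sandpile "SGC n" by (rule sandpile_SGC)
  show ?thesis
  proof
    fix v assume "v \<in> nonsink (SGC n)"
    then obtain w where w: "v = Some w" "w \<in> words n" by (auto simp: nonsink_SGC)
    then show "2 \<le> deg (SGC n) v" using assms by (simp add: deg_SGC)
    have "{x. x \<in> nonsink (SGC n) \<and> adj (SGC n) v x} = Some ` {v. cell_adj n w v}"
      unfolding nonsink_SGC w(1) by (auto simp: SGC_def dest: cell_adj_words)
    then have "laplacian (\<lambda>x. potential n (the x)) v =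
        3 * potential n w - (\<Sum>v | cell_adj n w v. potential n v)"
      using w assms by (simp add: laplacian_def deg_SGC sum.reindex)
    then show "laplacian (\<lambda>x. potential n (the x)) v = int (max_stable (SGC n) v)"
      using w assms by (simp add: potential_dirichlet max_stable_SGC nonsink_SGC)
  qed
qed

theorem theorem19:
  fixes n :: nat
  assumes "n > 0"
  shows "group (sandpile_group (SGC n)) \<and>
         \<one>\<^bsub>sandpile_group (SGC n)\<^esub> = (\<lambda>v. if v \<in> nonsink (SGC n) then 2 else 0)"
proof -
  interpret sandpile_potential "SGC n" "\<lambda>x. potential n (the x)"
    by (rule sandpile_potential_SGC[OF assms])
  show ?thesis
    using group_sandpile_group sandpile_group_one max_stable_SGC[OF assms] by simp
qed

end
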